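(* Let $\eta>0$ and $\mu>0$. If $w\in P(\mathbf{R}_+)$ and $w$ vanishes at the origin in the infinite order, or if $w\in Q(\mathbf{R}_+)$ and $w$ blows up at the origin in the infinite order, then the non-degenerate condition is not satisfied; that is, it is not true that $\inf_{0<\rho\le\varphi^{-1}(\eta)}H(\rho)>0$.
   Context: Notation: $\mathbf{R}_+=(0,\infty)$. Weight classes: $$W(\mathbf{R}_+)=\{w\in C^1(\mathbf{R}_+): w>0,\ \lim_{t\to+0}w(t)=a\text{ for some }a\in[0,\infty]\},$$ $$P(\mathbf{R}_+)=\{w\in W(\mathbf{R}_+): w^{-1}\notin L^1((0,\eta))\text{ for some }\eta>0\},$$ $$Q(\mathbf{R}_+)=\{w\in W(\mathbf{R}_+): w^{-1}\in L^1((0,\eta))\text{ for any }\eta>0\}.$$ Here $w^{-1}=1/w$. A weight $w\in P(\mathbf{R}_+)$ is said to vanish at the origin in the infinite order if for every positive integer $m$ there exists a positive number $t_m$, with $t_m\to0$ as $m\to\infty$, such that $w(t)\le t^m$ for all $t\in(0,t_m)$. A weight $w\in Q(\mathbf{R}_+)$ is said to blow up at the origin in the infinite order if for every positive integer $m$ there exists a positive number $t_m$, with $t_m\to0$ as $m\to\infty$, such that $w(t)\ge t^{-m}$ for all $t\in(0,t_m)$. The strictly increasing function $\varphi$ (depending on $w$, $\eta$, $\mu$) is defined as follows. If $w\in P(\mathbf{R}_+)$, $\varphi(\rho)$ is the unique solution of $\rho^{-1}=\mu+\int_{\varphi(\rho)}^{\eta}\frac{ds}{w(s)}$; if $w\in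 Q(\mathbf{R}_+)$, $\varphi(\rho)$ is the unique solution of $\rho=\int_0^{\varphi(\rho)}\frac{ds}{w(s)}$. Thus $\varphi^{-1}(t)=1/(\mu+\int_t^\eta\frac{ds}{w(s)})$ for $w\in P(\mathbf{R}_+)$ and $\varphi^{-1}(t)=\int_0^t\frac{ds}{w(s)}$ for $w\in Q(\mathbf{R}_+)$, for $0<t\le\eta$. For $0<\rho\le\varphi^{-1}(\eta)$, $H(\rho)=\dfrac{\rho\,\varphi'(\rho)}{\varphi(\rho)}$; explicitly $$H(\rho)=\frac{w(\varphi(\rho))}{\varphi(\rho)}\left(\mu+\int_{\varphi(\rho)}^\eta\frac{ds}{w(s)}\right)\ \text{ if }w\in P(\mathbf{R}_+),\qquad H(\rho)=\frac{w(\varphi(\rho))}{\varphi(\rho)}\int_0^{\varphi(\rho)}\frac{ds}{w(s)}\ \text{ if }w\in Q(\mathbf{R}_+).$$ *)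

theory Defs
  imports "HOL-Analysis.Analysis"
begin

(* A weight on the open half-line is represented by a total function of type real => real;
   only its values on {0<..} matter. *)

definition weights_W :: "(real \<Rightarrow> real) set" where
  "weights_W = {w. w C1_differentiable_on {0<..} \<and> (\<forall>t>0. w t > 0) \<and>
     (\<exists>a::ereal. 0 \<le> a \<and> ((\<lambda>t. ereal (w t)) \<longlongrightarrow> a) (at_right 0))}"

definition weights_P :: "(real \<Rightarrow> real) set" where
  "weights_P = {w \<in> weights_W. \<exists>\<eta>>0. \<not> set_integrable lborel {0<..<\<eta>} (\<lambda>t. 1 / w t)}"

definition weights_Q :: "(real \<Rightarrow> real) set" where
  "weights_Q = {w \<in> weights_W. \<forall>\<eta>>0. set_integrable lborel {0<..<\<eta>} (\<lambda>t. 1 / w t)}"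

definition vanishes_infinite_order :: "(real \<Rightarrow> real) \<Rightarrow> bool" where
  "vanishes_infinite_order w \<longleftrightarrow>
     (\<exists>t::nat \<Rightarrow> real. t \<longlonglongrightarrow> 0 \<and>
        (\<forall>m\<ge>1. t m > 0 \<and> (\<forall>s\<in>{0<..<t m}. w s \<le> s ^ m)))"

definition blows_up_infinite_order :: "(real \<Rightarrow> real) \<Rightarrow> bool" where
  "blows_up_infinite_order w \<longleftrightarrow>
     (\<exists>t::nat \<Rightarrow> real. t \<longlonglongrightarrow> 0 \<and>
        (\<forall>m\<ge>1. t m > 0 \<and> (\<forall>s\<in>{0<..<t m}. w s \<ge> s powi (- int m))))"

(* The classes P and Q partition W, so testing membership in P selects the right formula.
   phi maps {0<..phi_inv w \<eta> \<mu> \<eta>} onto {0<..\<eta>}; outside that domain its value is unspecified. *)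

definition phi_inv :: "(real \<Rightarrow> real) \<Rightarrow> real \<Rightarrow> real \<Rightarrow> real \<Rightarrow> real" where
  "phi_inv w \<eta> \<mu> t =
     (if w \<in> weights_P then 1 / (\<mu> + (LBINT s:{t..\<eta>}. 1 / w s))
      else (LBINT s:{0<..t}. 1 / w s))"

definition phi :: "(real \<Rightarrow> real) \<Rightarrow> real \<Rightarrow> real \<Rightarrow> real \<Rightarrow> real" where
  "phi w \<eta> \<mu> \<rho> =
     (if w \<in> weights_P
      then (THE t. t \<in> {0<..\<eta>} \<and> 1 / \<rho> = \<mu> + (LBINT s:{t..\<eta>}. 1 / w s))
      else (THE t. t \<in> {0<..\<eta>} \<and> \<rho> = (LBINT s:{0<..t}. 1 / w s)))"

(* The derivative is taken within the domain of phi, hence is one-sided at the right endpoint. *)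

definition H :: "(real \<Rightarrow> real) \<Rightarrow> real \<Rightarrow> real \<Rightarrow> real \<Rightarrow> real" where
  "H w \<eta> \<mu> \<rho> =
     \<rho> * vector_derivative (phi w \<eta> \<mu>) (at \<rho> within {0<..phi_inv w \<eta> \<mu> \<eta>}) / phi w \<eta> \<mu> \<rho>"

(* The infimum is taken in the extended reals, where it always exists. *)

definition nondegenerate :: "(real \<Rightarrow> real) \<Rightarrow> real \<Rightarrow> real \<Rightarrow> bool" where
  "nondegenerate w \<eta> \<mu> \<longleftrightarrow> (INF \<rho>\<in>{0<..phi_inv w \<eta> \<mu> \<eta>}. ereal (H w \<eta> \<mu> \<rho>)) > 0"

end

theory Submission
  imports Defs
begin

text \<open>
  Write \<open>G\<close> for \<open>phi_inv w \<eta> \<mu>\<close>, the inverse of \<open>phi\<close>. Differentiating the inverse function gives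
  \<open>H (G t) = G t / (t * G' t)\<close> for \<open>0 < t < \<eta>\<close> (lemma \<open>H_phi_inv\<close>). A positive lower bound for \<open>H\<close>
  is therefore an upper bound \<open>t * G' t \<le> k * G t\<close> on the logarithmic derivative of \<open>G\<close>, and
  integrating it from \<open>t\<close> to \<open>\<eta>\<close> shows that \<open>G\<close> decays at most polynomially at the origin:
  \<open>G t \<ge> B * t ^ k\<close> with \<open>B > 0\<close> (lemma \<open>power_lower_bound_of_log_derivative\<close>).

  On the other hand, if \<open>w\<close> vanishes or blows up in the infinite order, then \<open>G\<close> is flat at the
  origin: for every \<open>n\<close> there is a \<open>C\<close> with \<open>G t \<le> C * t ^ n\<close> near \<open>0\<close>. If \<open>w s \<le> s ^ m\<close> near \<open>0\<close>,
  this holds because \<open>1 / G t\<close> is at least the integral of \<open>1 / w\<close> over \<open>{t..2 * t}\<close>, hence at least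
  \<open>t / (2 * t) ^ m\<close>. If \<open>w s \<ge> s powi (- m)\<close> near \<open>0\<close>, it holds because \<open>G t\<close> is the integral of
  \<open>1 / w\<close> over \<open>{0<..t}\<close>, hence at most \<open>t * t ^ m\<close>. Taking \<open>n = k + 1\<close>, the lower and the upper
  bound for \<open>G\<close> contradict each other as \<open>t\<close> tends to \<open>0\<close> (lemma \<open>degenerate_of_flat_phi_inv\<close>).
\<close>

lemma strict_mono_on_of_pos_derivative:
  fixes G :: "real \<Rightarrow> real"
  assumes der: "\<And>t. t \<in> {0<..\<eta>} \<Longrightarrow> (G has_real_derivative G' t) (at t within {0<..\<eta>})"
    and pos: "\<And>t. t \<in> {0<..\<eta>} \<Longrightarrow> G' t > 0"
  shows "strict_mono_on {0<..\<eta>} G"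
proof (rule strict_mono_onI)
  fix r s assume rs: "r \<in> {0<..\<eta>}" "s \<in> {0<..\<eta>}" "r < s"
  have cont: "continuous_on {r..s} G"
    by (rule continuous_on_subset[OF DERIV_continuous_on[OF der]]) (use rs in auto)
  have "\<exists>y. (G has_real_derivative y) (at x) \<and> 0 < y" if "r < x" "x < s" for x
  proof -
    have "at x within {0<..\<eta>} = at x"
      using that rs by (intro at_within_interior) auto
    then show ?thesis using der[of x] pos[of x] that rs by auto
  qed
  then show "G r < G s"
    using DERIV_pos_imp_increasing_open[OF \<open>r < s\<close> _ cont] by blast
qed

text \<open>The hypothesis \<open>log\<close> says that \<open>ln (G t) - k * ln t\<close> is nonincreasing.\<close>

lemma power_lower_bound_of_log_derivative:
  fixes G :: "real \<Rightarrow> real" and k :: nat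
  assumes der: "\<And>t. t \<in> {0<..\<eta>} \<Longrightarrow> (G has_real_derivative G' t) (at t within {0<..\<eta>})"
    and pos: "\<And>t. t \<in> {0<..\<eta>} \<Longrightarrow> G t > 0"
    and log: "\<And>t. t \<in> {0<..<\<eta>} \<Longrightarrow> t * G' t \<le> k * G t"
    and t: "t \<in> {0<..\<eta>}"
  shows "G t \<ge> G \<eta> / \<eta> ^ k * t ^ k"
proof -
  have contG: "continuous_on {t..\<eta>} G"
    by (rule continuous_on_subset[OF DERIV_continuous_on[OF der]]) (use t in auto)
  have cont: "continuous_on {t..\<eta>} (\<lambda>x. ln (G x) - k * ln x)"
    using t pos by (intro continuous_intros contG) (auto simp: less_imp_neq[symmetric])
  have "\<exists>y. ((\<lambda>x. ln (G x) - k * ln x) has_real_derivative y) (at x) \<and> y \<le> 0"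
    if "t < x" "x < \<eta>" for x
  proof -
    have "at x within {0<..\<eta>} = at x"
      using that t by (intro at_within_interior) auto
    then have "(G has_real_derivative G' x) (at x)" and "G x > 0" and x: "x > 0"
      using der[of x] pos[of x] that t by auto
    then have "((\<lambda>x. ln (G x) - k * ln x) has_real_derivative G' x / G x - k / x) (at x)"
      by (auto intro!: derivative_eq_intros simp: field_simps)
    moreover have "G' x / G x - k / x \<le> 0"
      using log[of x] that x \<open>G x > 0\<close> by (simp add: field_simps)
    ultimately show ?thesis by blast
  qed
  then have "ln (G \<eta>) - k * ln \<eta> \<le> ln (G t) - k * ln t"
    using t by (intro DERIV_nonpos_imp_decreasing_open[OF _ _ cont]) auto
  then have "ln (G \<eta> / \<eta> ^ k * t ^ k) \<le> ln (G t)"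
    using t pos[of t] pos[of \<eta>] by (simp add: ln_mult ln_div ln_realpow)
  then show ?thesis
    using t pos[of t] pos[of \<eta>] by (subst (asm) ln_le_cancel_iff) auto
qed

text \<open>
  The right endpoint \<open>t = \<eta>\<close> is left out: for \<open>t < \<eta>\<close> the derivative within the domain of
  \<open>phi\<close> is an ordinary derivative, and the inverse function theorem applies.
\<close>

lemma H_phi_inv:
  assumes der: "\<And>t. t \<in> {0<..\<eta>} \<Longrightarrow>
      (phi_inv w \<eta> \<mu> has_real_derivative G' t) (at t within {0<..\<eta>})"
    and G'_pos: "\<And>t. t \<in> {0<..\<eta>} \<Longrightarrow> G' t > 0"
    and G_pos: "\<And>t. t \<in> {0<..\<eta>} \<Longrightarrow> phi_inv w \<eta> \<mu> t > 0"
    and inv: "\<And>t. t \<in> {0<..\<eta>} \<Longrightarrow> phi w \<eta> \<mu> (phi_inv w \<eta> \<mu> t) = t"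
    and t: "t \<in> {0<..<\<eta>}"
  shows "phi_inv w \<eta> \<mu> t \<in> {0<..phi_inv w \<eta> \<mu> \<eta>}"
    and "H w \<eta> \<mu> (phi_inv w \<eta> \<mu> t) = phi_inv w \<eta> \<mu> t / (t * G' t)"
proof -
  let ?G = "phi_inv w \<eta> \<mu>"
  have less: "?G t < ?G \<eta>"
    using strict_mono_onD[OF strict_mono_on_of_pos_derivative[OF der G'_pos]] t by auto
  then show "?G t \<in> {0<..?G \<eta>}" using G_pos[of t] t by auto
  have "at t within {0<..\<eta>} = at t"
    using t by (intro at_within_interior) auto
  then have "(?G has_real_derivative G' t) (at t)" using der[of t] t by auto
  moreover have "continuous_on {0<..<\<eta>} ?G"
    by (rule continuous_on_subset[OF DERIV_continuous_on[OF der]]) auto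
  ultimately have "(phi w \<eta> \<mu> has_derivative (*) (inverse (G' t))) (at (?G t))"
    using t inv G'_pos[of t]
    by (intro has_derivative_inverse_strong[where S="{0<..<\<eta>}" and f="?G" and f'="(*) (G' t)"])
      (auto simp: has_field_derivative_def fun_eq_iff)
  then have "(phi w \<eta> \<mu> has_real_derivative inverse (G' t)) (at (?G t))"
    by (simp add: has_field_derivative_def)
  moreover have "at (?G t) within {0<..?G \<eta>} = at (?G t)"
    using less G_pos[of t] t by (intro at_within_interior) auto
  ultimately have "vector_derivative (phi w \<eta> \<mu>) (at (?G t) within {0<..?G \<eta>}) = inverse (G' t)"
    by (simp add: has_real_derivative_iff_has_vector_derivative vector_derivative_at)
  then show "H w \<eta> \<mu> (?G t) = ?G t / (t * G' t)"
    using inv[of t] t by (simp add: H_def field_simps)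
qed

text \<open>The contradiction between a positive infimum of \<open>H\<close> and flatness of the inverse of \<open>phi\<close>.\<close>

lemma degenerate_of_flat_phi_inv:
  assumes eta: "\<eta> > 0"
    and der: "\<And>t. t \<in> {0<..\<eta>} \<Longrightarrow>
      (phi_inv w \<eta> \<mu> has_real_derivative G' t) (at t within {0<..\<eta>})"
    and G'_pos: "\<And>t. t \<in> {0<..\<eta>} \<Longrightarrow> G' t > 0"
    and G_pos: "\<And>t. t \<in> {0<..\<eta>} \<Longrightarrow> phi_inv w \<eta> \<mu> t > 0"
    and inv: "\<And>t. t \<in> {0<..\<eta>} \<Longrightarrow> phi w \<eta> \<mu> (phi_inv w \<eta> \<mu> t) = t"
    and flat: "\<And>n. n \<ge> 1 \<Longrightarrow> \<exists>C d. d > 0 \<and> (\<forall>t\<in>{0<..<d}. phi_inv w \<eta> \<mu> t \<le> C * t ^ n)"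
  shows "\<not> nondegenerate w \<eta> \<mu>"
proof
  let ?G = "phi_inv w \<eta> \<mu>"
  assume "nondegenerate w \<eta> \<mu>"
  then have "0 < (INF \<rho>\<in>{0<..?G \<eta>}. ereal (H w \<eta> \<mu> \<rho>))"
    by (simp add: nondegenerate_def)
  then obtain c where c: "0 < ereal c" "ereal c < (INF \<rho>\<in>{0<..?G \<eta>}. ereal (H w \<eta> \<mu> \<rho>))"
    using ereal_dense2 by blast
  have H_ge: "c \<le> H w \<eta> \<mu> \<rho>" if "\<rho> \<in> {0<..?G \<eta>}" for \<rho>
  proof -
    have "ereal c \<le> ereal (H w \<eta> \<mu> \<rho>)"
      using less_le_trans[OF c(2) INF_lower[OF that]] by simp
    then show ?thesis by simp
  qed
  \<comment> \<open>Rounding the exponent \<open>1 / c\<close> up to an integer only weakens the bound.\<close>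
  obtain k :: nat where k: "1 / c \<le> k" using real_arch_simple by blast
  have log: "t * G' t \<le> k * ?G t" if t: "t \<in> {0<..<\<eta>}" for t
  proof -
    have pos: "t > 0" "G' t > 0" "?G t > 0" using t G'_pos[of t] G_pos[of t] by auto
    have "c \<le> ?G t / (t * G' t)"
      using H_ge[OF H_phi_inv(1)[OF der G'_pos G_pos inv t]]
        H_phi_inv(2)[OF der G'_pos G_pos inv t] by simp
    then have "t * G' t \<le> 1 / c * ?G t"
      using pos c(1) by (simp add: field_simps)
    also have "\<dots> \<le> k * ?G t" using k pos by (intro mult_right_mono) auto
    finally show ?thesis .
  qed
  define B where "B = ?G \<eta> / \<eta> ^ k"
  have B: "B > 0" using G_pos[of \<eta>] eta by (simp add: B_def)
  have lower: "B * t ^ k \<le> ?G t" if "t \<in> {0<..\<eta>}" for t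
    unfolding B_def using power_lower_bound_of_log_derivative[OF der G_pos log that] by simp
  obtain C d where d: "d > 0" and upper: "\<And>t. t \<in> {0<..<d} \<Longrightarrow> ?G t \<le> C * t ^ Suc k"
    using flat[of "Suc k"] by (metis le_add1 plus_1_eq_Suc)
  have B_le: "B \<le> C * t" if "0 < t" "t < min d \<eta>" for t
  proof -
    have "B * t ^ k \<le> C * t ^ Suc k"
      using that by (intro order_trans[OF lower upper]) auto
    then have "B * t ^ k \<le> (C * t) * t ^ k" by (simp only: power_Suc mult.assoc)
    then show ?thesis using that by (intro mult_right_le_imp_le[of B "t ^ k"]) auto
  qed
  have "((\<lambda>t. C * t) \<longlongrightarrow> C * 0) (at_right 0)"
    by (intro tendsto_intros)
  moreover have "eventually (\<lambda>t. B \<le> C * t) (at_right 0)"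
    using B_le d eta by (intro eventually_at_rightI[of 0 "min d \<eta>"]) auto
  ultimately have "B \<le> C * 0"
    by (intro tendsto_lowerbound) auto
  then show False using B by simp
qed

lemma weights_W_recip_continuous:
  assumes "w \<in> weights_W"
  shows "continuous_on {0<..} (\<lambda>t. 1 / w t)"
proof (rule continuous_on_divide[OF continuous_on_const])
  show "continuous_on {0<..} w"
    using assms by (simp add: weights_W_def C1_differentiable_imp_continuous_on)
  show "\<forall>t\<in>{0<..}. w t \<noteq> 0"
    using assms by (fastforce simp: weights_W_def)
qed

lemma set_integrable_Icc_of_continuous:
  fixes f :: "real \<Rightarrow> real"
  assumes "continuous_on {0<..} f" "0 < a"
  shows "set_integrable lborel {a..b} f"
proof (rule borel_integrable_atLeastAtMost')
  show "continuous_on {a..b} f"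
    by (rule continuous_on_subset[OF assms(1)]) (use assms(2) in auto)
qed

text \<open>
  The derivative at \<open>t = \<eta>\<close> is one-sided: \<open>{t..\<eta>}\<close> is empty for \<open>t > \<eta>\<close>, so the tail integral has a
  kink there unless \<open>f \<eta> = 0\<close>.
\<close>

lemma tail_integral_has_derivative:
  fixes f :: "real \<Rightarrow> real"
  assumes cont: "continuous_on {0<..} f" and t: "t \<in> {0<..\<eta>}"
  shows "((\<lambda>t. LBINT s:{t..\<eta>}. f s) has_real_derivative - f t) (at t within {0<..\<eta>})"
proof -
  define a where "a = t / 2"
  have a: "0 < a" "a < t" using t by (auto simp: a_def)
  have contI: "continuous_on {x..y} f" if "0 < x" for x y
    by (rule continuous_on_subset[OF cont]) (use that in auto)
  have "((\<lambda>u. integral {a..u} f) has_real_derivative f t) (at t within {a..\<eta>})"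
    using a t by (intro integral_has_real_derivative contI) auto
  then have "((\<lambda>u. integral {a..\<eta>} f - integral {a..u} f) has_real_derivative - f t)
      (at t within {a..\<eta>})"
    by (auto intro!: derivative_eq_intros)
  then have "((\<lambda>u. LBINT s:{u..\<eta>}. f s) has_real_derivative - f t) (at t within {a..\<eta>})"
  proof (rule has_field_derivative_transform_within[OF _ zero_less_one])
    show "t \<in> {a..\<eta>}" using a t by auto
    fix u assume u: "u \<in> {a..\<eta>}"
    have "(LBINT s:{u..\<eta>}. f s) = integral {u..\<eta>} f"
      using a u by (intro set_borel_integral_eq_integral set_integrable_Icc_of_continuous cont) auto
    also have "\<dots> = integral {a..\<eta>} f - integral {a..u} f"
      using Henstock_Kurzweil_Integration.integral_combine[of a u \<eta> f]
        integrable_continuous_real[OF contI[OF a(1)]] u by force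
    finally show "integral {a..\<eta>} f - integral {a..u} f = (LBINT s:{u..\<eta>}. f s)" ..
  qed
  moreover have "at t within {0<..\<eta>} = at t within {a..\<eta>}"
    using a t by (intro at_within_nhd[where S="{a<..}"]) auto
  ultimately show ?thesis by simp
qed

text \<open>
  Up to a constant, the integral from the origin is minus the tail integral; continuity of \<open>f\<close> at
  the origin is not needed.
\<close>

lemma initial_integral_has_derivative:
  fixes f :: "real \<Rightarrow> real"
  assumes cont: "continuous_on {0<..} f" and int: "set_integrable lborel {0<..\<eta>} f"
    and t: "t \<in> {0<..\<eta>}"
  shows "((\<lambda>t. LBINT s:{0<..t}. f s) has_real_derivative f t) (at t within {0<..\<eta>})"
proof -
  have "((\<lambda>t. (LBINT s:{0<..\<eta>}. f s) - (LBINT s:{t..\<eta>}. f s)) has_real_derivative f t)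
      (at t within {0<..\<eta>})"
    using tail_integral_has_derivative[OF cont t] by (auto intro!: derivative_eq_intros)
  then show ?thesis
  proof (rule has_field_derivative_transform_within[OF _ zero_less_one t])
    fix u assume u: "u \<in> {0<..\<eta>}"
    have "(LBINT s:{0<..\<eta>}. f s) = (LBINT s:{0<..u} \<union> {u<..\<eta>}. f s)"
      using u by (intro arg_cong[where f="\<lambda>A. LBINT s:A. f s"]) auto
    also have "\<dots> = (LBINT s:{0<..u}. f s) + (LBINT s:{u<..\<eta>}. f s)"
      using u by (intro set_integral_Un) (auto intro: set_integrable_subset[OF int])
    also have "(LBINT s:{u<..\<eta>}. f s) = (LBINT s:{u..\<eta>}. f s)"
    proof (rule set_integral_cong_set)
      have meas: "set_borel_measurable lborel A f" if "set_integrable lborel A f" for A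
        using borel_measurable_integrable that
        unfolding set_borel_measurable_def set_integrable_def by blast
      show "set_borel_measurable lborel {u..\<eta>} f"
        using u by (intro meas set_integrable_Icc_of_continuous cont) auto
      show "set_borel_measurable lborel {u<..\<eta>} f"
        using u by (intro meas set_integrable_subset[OF int]) auto
      show "AE x in lborel. x \<in> {u..\<eta>} \<longleftrightarrow> x \<in> {u<..\<eta>}"
        using AE_lborel_singleton[of u] by eventually_elim auto
    qed
    finally show "(LBINT s:{0<..\<eta>}. f s) - (LBINT s:{u..\<eta>}. f s) = (LBINT s:{0<..u}. f s)"
      by simp
  qed
qed

lemma degenerate_of_vanishing:
  assumes eta: "\<eta> > 0" and mu: "\<mu> > 0"
    and w: "w \<in> weights_P" and van: "vanishes_infinite_order w"
  shows "\<not> nondegenerate w \<eta> \<mu>"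
proof -
  define f where "f = (\<lambda>s. 1 / w s)"
  define I where "I = (\<lambda>t. LBINT s:{t..\<eta>}. f s)"
  have W: "w \<in> weights_W" using w by (simp add: weights_P_def)
  have w_pos: "w s > 0" if "s > 0" for s using W that by (auto simp: weights_W_def)
  then have f_pos: "f s > 0" if "s > 0" for s using that by (simp add: f_def)
  then have f_nonneg: "f s \<ge> 0" if "s > 0" for s using that by (simp add: less_imp_le)
  have cont: "continuous_on {0<..} f"
    unfolding f_def by (rule weights_W_recip_continuous[OF W])
  have f_int: "f integrable_on {x..y}" if "x > 0" for x y
    by (intro integrable_continuous_real continuous_on_subset[OF cont]) (use that in auto)
  have I_eq: "I t = integral {t..\<eta>} f" if "t > 0" for t
    unfolding I_def
    by (intro set_borel_integral_eq_integral set_integrable_Icc_of_continuous cont that)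
  have I_nonneg: "I t \<ge> 0" if "t > 0" for t
    unfolding I_eq[OF that]
    by (intro integral_nonneg f_int that) (use f_nonneg that in auto)
  have G: "phi_inv w \<eta> \<mu> = (\<lambda>t. 1 / (\<mu> + I t))"
    using w by (auto simp: phi_inv_def I_def f_def)
  define G' where "G' = (\<lambda>t. f t / (\<mu> + I t)\<^sup>2)"
  have der: "(phi_inv w \<eta> \<mu> has_real_derivative G' t) (at t within {0<..\<eta>})"
    if t: "t \<in> {0<..\<eta>}" for t
  proof -
    have "\<mu> + I t \<noteq> 0" using I_nonneg[of t] t mu by auto
    then show ?thesis
      unfolding G G'_def
      using tail_integral_has_derivative[OF cont t, folded I_def]
      by (auto intro!: derivative_eq_intros simp: power2_eq_square)
  qed
  have G_pos: "phi_inv w \<eta> \<mu> t > 0" if "t \<in> {0<..\<eta>}" for t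
    using I_nonneg[of t] mu that by (simp add: G)
  have G'_pos: "G' t > 0" if "t \<in> {0<..\<eta>}" for t
    using I_nonneg[of t] f_pos[of t] mu that by (simp add: G'_def)
  have inj: "inj_on (phi_inv w \<eta> \<mu>) {0<..\<eta>}"
    by (rule strict_mono_on_imp_inj_on[OF strict_mono_on_of_pos_derivative[OF der G'_pos]])
  have inv: "phi w \<eta> \<mu> (phi_inv w \<eta> \<mu> t) = t" if t: "t \<in> {0<..\<eta>}" for t
  proof -
    have "(THE u. u \<in> {0<..\<eta>} \<and> 1 / phi_inv w \<eta> \<mu> t = \<mu> + I u) = t"
    proof (rule the_equality)
      fix u assume u: "u \<in> {0<..\<eta>} \<and> 1 / phi_inv w \<eta> \<mu> t = \<mu> + I u"
      then have "phi_inv w \<eta> \<mu> u = phi_inv w \<eta> \<mu> t" by (simp add: G)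
      with u t show "u = t" using inj by (auto dest: inj_onD)
    qed (use t in \<open>simp add: G\<close>)
    then show ?thesis using w by (simp add: phi_def I_def f_def)
  qed
  have flat: "\<exists>C d. d > 0 \<and> (\<forall>t\<in>{0<..<d}. phi_inv w \<eta> \<mu> t \<le> C * t ^ n)" for n
  proof -
    \<comment> \<open>Order \<open>Suc n\<close> rather than \<open>n\<close>: the length \<open>t\<close> of \<open>{t..2 * t}\<close> costs one power of \<open>t\<close>.\<close>
    obtain r where r: "r > 0" and w_le: "\<And>s. s \<in> {0<..<r} \<Longrightarrow> w s \<le> s ^ Suc n"
      using van unfolding vanishes_infinite_order_def by (metis le_add1 plus_1_eq_Suc)
    have "phi_inv w \<eta> \<mu> t \<le> 2 ^ Suc n * t ^ n" if t: "0 < t" "t < min (r / 2) (\<eta> / 2)" for t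
    proof -
      have "1 / (2 ^ Suc n * t ^ n) = integral {t..2 * t} (\<lambda>s. 1 / (2 * t) ^ Suc n)"
        using t by (simp add: field_simps)
      also have "\<dots> \<le> integral {t..2 * t} f"
      proof (intro integral_le f_int)
        fix s assume s: "s \<in> {t..2 * t}"
        have "w s \<le> s ^ Suc n" using w_le[of s] s t by auto
        also have "\<dots> \<le> (2 * t) ^ Suc n" using s t by (intro power_mono) auto
        finally show "1 / (2 * t) ^ Suc n \<le> f s"
          unfolding f_def using w_pos[of s] s t by (intro divide_left_mono) auto
      qed (use t in auto)
      also have "\<dots> \<le> integral {t..\<eta>} f"
        using t f_nonneg by (intro integral_subset_le f_int) auto
      also have "\<dots> \<le> \<mu> + I t" using I_eq[of t] t mu by simp
      finally have "1 / (\<mu> + I t) \<le> 1 / (1 / (2 ^ Suc n * t ^ n))"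
        using t I_nonneg[of t] mu by (intro divide_left_mono) auto
      then show ?thesis by (simp add: G)
    qed
    then show ?thesis using r eta
      by (intro exI[of _ "2 ^ Suc n"] exI[of _ "min (r / 2) (\<eta> / 2)"]) auto
  qed
  show ?thesis
    by (rule degenerate_of_flat_phi_inv[OF eta der G'_pos G_pos inv flat])
qed

lemma degenerate_of_blowing_up:
  assumes eta: "\<eta> > 0"
    and w: "w \<in> weights_Q" and blow: "blows_up_infinite_order w"
  shows "\<not> nondegenerate w \<eta> \<mu>"
proof -
  define f where "f = (\<lambda>s. 1 / w s)"
  have W: "w \<in> weights_W" and notP: "w \<notin> weights_P"
    using w by (auto simp: weights_Q_def weights_P_def)
  have w_pos: "w s > 0" if "s > 0" for s using W that by (auto simp: weights_W_def)
  then have f_pos: "f s > 0" if "s > 0" for s using that by (simp add: f_def)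
  then have f_nonneg: "f s \<ge> 0" if "s > 0" for s using that by (simp add: less_imp_le)
  have cont: "continuous_on {0<..} f"
    unfolding f_def by (rule weights_W_recip_continuous[OF W])
  have f_int: "set_integrable lborel {0<..t} f" for t
  proof (rule set_integrable_subset)
    show "set_integrable lborel {0<..<max 1 (t + 1)} f"
      using w by (simp add: weights_Q_def f_def)
  qed auto
  have G: "phi_inv w \<eta> \<mu> = (\<lambda>t. LBINT s:{0<..t}. f s)"
    using notP by (auto simp: phi_inv_def f_def)
  have der: "(phi_inv w \<eta> \<mu> has_real_derivative f t) (at t within {0<..\<eta>})"
    if t: "t \<in> {0<..\<eta>}" for t
    unfolding G by (rule initial_integral_has_derivative[OF cont f_int t])
  have f_pos': "f t > 0" if "t \<in> {0<..\<eta>}" for t using f_pos that by simp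
  note mono = strict_mono_on_of_pos_derivative[OF der f_pos']
  have G_pos: "phi_inv w \<eta> \<mu> t > 0" if t: "t \<in> {0<..\<eta>}" for t
  proof -
    \<comment> \<open>The integral up to \<open>t / 2\<close> is nonnegative; strictness comes from monotonicity.\<close>
    have "0 \<le> phi_inv w \<eta> \<mu> (t / 2)"
      unfolding G set_lebesgue_integral_def
      using f_nonneg by (intro Bochner_Integration.integral_nonneg) (auto simp: indicator_def)
    also have "\<dots> < phi_inv w \<eta> \<mu> t" using t by (intro strict_mono_onD[OF mono]) auto
    finally show ?thesis .
  qed
  have inv: "phi w \<eta> \<mu> (phi_inv w \<eta> \<mu> t) = t" if t: "t \<in> {0<..\<eta>}" for t
  proof -
    have "(THE u. u \<in> {0<..\<eta>} \<and> phi_inv w \<eta> \<mu> t = phi_inv w \<eta> \<mu> u) = t"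
      using t strict_mono_on_imp_inj_on[OF mono]
      by (intro the_equality) (auto dest: inj_onD)
    then show ?thesis using notP by (simp add: phi_def G f_def)
  qed
  have flat: "\<exists>C d. d > 0 \<and> (\<forall>t\<in>{0<..<d}. phi_inv w \<eta> \<mu> t \<le> C * t ^ n)" if n: "n \<ge> 1" for n
  proof -
    obtain r where r: "r > 0" and w_ge: "\<And>s. s \<in> {0<..<r} \<Longrightarrow> w s \<ge> s powi (- int n)"
      using blow n unfolding blows_up_infinite_order_def by metis
    have "phi_inv w \<eta> \<mu> t \<le> r * t ^ n" if t: "t \<in> {0<..<r}" for t
    proof -
      have "phi_inv w \<eta> \<mu> t \<le> (LBINT s:{0<..t}. t ^ n)"
        unfolding G
      proof (intro set_integral_mono f_int)
        show "set_integrable lborel {0<..t} (\<lambda>s. t ^ n)"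
          by (rule set_integrable_subset[OF borel_integrable_atLeastAtMost'[of 0 t]]) auto
        fix s assume s: "s \<in> {0<..t}"
        have "1 / s ^ n \<le> w s"
          using w_ge[of s] s t by (simp add: power_int_minus divide_inverse)
        then have "f s \<le> s ^ n"
          unfolding f_def using s w_pos[of s] by (simp add: field_simps)
        also have "\<dots> \<le> t ^ n" using s by (intro power_mono) auto
        finally show "f s \<le> t ^ n" .
      qed
      also have "\<dots> = t * t ^ n"
        using t by (simp add: set_lebesgue_integral_def)
      also have "\<dots> \<le> r * t ^ n" using t by (intro mult_right_mono) auto
      finally show ?thesis .
    qed
    then show ?thesis using r by blast
  qed
  show ?thesis
    by (rule degenerate_of_flat_phi_inv[OF eta der f_pos' G_pos inv flat])
qed

theorem theorem3p3:
  fixes w :: "real \<Rightarrow> real" and \<eta> \<mu> :: real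
  assumes "\<eta> > 0" and "\<mu> > 0"
    and "(w \<in> weights_P \<and> vanishes_infinite_order w) \<or>
         (w \<in> weights_Q \<and> blows_up_infinite_order w)"
  shows "\<not> nondegenerate w \<eta> \<mu>"
  using assms(3) degenerate_of_vanishing[OF assms(1,2)] degenerate_of_blowing_up[OF assms(1)]
  by auto

end
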